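(* Let $\Gamma$ be a countable discrete group and let $V\subset\ell_2(\Gamma)$ be a closed subspace. The following are equivalent: (i) $V$ is left-invariant, i.e. $\lambda(\gamma)V\subset V$ for all $\gamma\in\Gamma$; (ii) there exists an orthogonal projection $q\in\mathcal{R}(\Gamma)$ of $\ell_2(\Gamma)$ such that $\mathcal{F}_\Gamma(V)=qL^2(\mathcal{R}(\Gamma))$. Moreover, in this case $q=\mathbb{P}_V$, the orthogonal projection onto $V$.
   Context: $\{\delta_\gamma\}$ is the canonical basis of $\ell_2(\Gamma)$; $\lambda(\gamma)\delta_{\gamma'}=\delta_{\gamma\gamma'}$ is the left regular representation and $\rho(\gamma)\delta_{\gamma'}=\delta_{\gamma'\gamma^{-1}}$ the right regular representation. $\mathcal{R}(\Gamma)$ is the weak-operator-topology closure of $\mathrm{span}\{\rho(\gamma)\}$, with trace $\tau(F)=\langle F\delta_{\mathrm e},\delta_{\mathrm e}\rangle$. $L^2(\mathcal{R}(\Gamma))$ is the completion of $\mathrm{span}\{\rho(\gamma)\}$ in the norm $\tau(F^*F)^{1/2}$ (operators affiliated to $\mathcal{R}(\Gamma)$), in which $\{\rho(\gamma)\}$ is an orthonormal basis. The group Fourier transform $\mathcal{F}_\Gamma:\ell_2(\Gamma)\to L^2(\mathcal{R}(\Gamma))$ is $\mathcal{F}_\Gamma f=\sum_{\gamma}f(\gamma)\rho(\gamma)^*$ (a unitary, Plancherel). For an orthogonal projection $q\in\mathcal{R}(\Gamma)$, $qL^2(\mathcal{R}(\Gamma))=\{qF: F\in L^2(\mathcal{R}(\Gamma))\}$.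 *)

theory Defs
  imports "HOL-Analysis.Analysis"
begin

text \<open>The group \<Gamma> is a type of class group_add (written additively, not necessarily
  commutative) and countable; it carries the discrete topology implicitly.
  Vectors of l2(\<Gamma>) are functions \<Gamma> \<Rightarrow> complex that are square summable.\<close>

definition l2 :: "('g \<Rightarrow> complex) set" where
  "l2 = {f. (\<lambda>x. (cmod (f x))\<^sup>2) summable_on UNIV}"

definition l2_inner :: "('g \<Rightarrow> complex) \<Rightarrow> ('g \<Rightarrow> complex) \<Rightarrow> complex" where
  "l2_inner f g = (\<Sum>\<^sub>\<infinity>x. f x * cnj (g x))"

definition l2_norm :: "('g \<Rightarrow> complex) \<Rightarrow> real" where
  "l2_norm f = sqrt (\<Sum>\<^sub>\<infinity>x. (cmod (f x))\<^sup>2)"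

definition closed_subspace_l2 :: "('g \<Rightarrow> complex) set \<Rightarrow> bool" where
  "closed_subspace_l2 V \<longleftrightarrow> V \<subseteq> l2 \<and> (\<lambda>x. 0) \<in> V \<and>
     (\<forall>f\<in>V. \<forall>g\<in>V. (\<lambda>x. f x + g x) \<in> V) \<and>
     (\<forall>c. \<forall>f\<in>V. (\<lambda>x. c * f x) \<in> V) \<and>
     (\<forall>s f. (\<forall>n. s n \<in> V) \<longrightarrow> f \<in> l2 \<longrightarrow>
        (\<lambda>n. l2_norm (\<lambda>x. s n x - f x)) \<longlonglongrightarrow> 0 \<longrightarrow> f \<in> V)"

text \<open>Left regular representation: lambda(g) delta_h = delta_(g+h), i.e.
  (lambda(g) f)(x) = f(-g + x).
  Right regular representation: rho(g) delta_h = delta_(h - g), i.e.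
  (rho(g) f)(x) = f(x + g).  Its adjoint is rho(g)^* = rho(-g).\<close>
definition lam :: "'g::group_add \<Rightarrow> ('g \<Rightarrow> complex) \<Rightarrow> ('g \<Rightarrow> complex)" where
  "lam g f = (\<lambda>x. f (- g + x))"

definition rho :: "'g::group_add \<Rightarrow> ('g \<Rightarrow> complex) \<Rightarrow> ('g \<Rightarrow> complex)" where
  "rho g f = (\<lambda>x. f (x + g))"

definition rho_adj :: "'g::group_add \<Rightarrow> ('g \<Rightarrow> complex) \<Rightarrow> ('g \<Rightarrow> complex)" where
  "rho_adj g = rho (- g)"

definition left_invariant :: "('g::group_add \<Rightarrow> complex) set \<Rightarrow> bool" where
  "left_invariant V \<longleftrightarrow> (\<forall>g. \<forall>f\<in>V. lam g f \<in> V)"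

text \<open>Bounded operators on l2 (operators are total functions; only their values on l2 matter).\<close>
definition bounded_op_l2 :: "(('g \<Rightarrow> complex) \<Rightarrow> ('g \<Rightarrow> complex)) \<Rightarrow> bool" where
  "bounded_op_l2 T \<longleftrightarrow> (\<forall>f\<in>l2. T f \<in> l2) \<and>
     (\<forall>f\<in>l2. \<forall>g\<in>l2. \<forall>a b. T (\<lambda>x. a * f x + b * g x) = (\<lambda>x. a * T f x + b * T g x)) \<and>
     (\<exists>C. \<forall>f\<in>l2. l2_norm (T f) \<le> C * l2_norm f)"

definition orth_proj_l2 :: "(('g \<Rightarrow> complex) \<Rightarrow> ('g \<Rightarrow> complex)) \<Rightarrow> bool" where
  "orth_proj_l2 q \<longleftrightarrow> bounded_op_l2 q \<and> (\<forall>f\<in>l2. q (q f) = q f) \<and>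
     (\<forall>f\<in>l2. \<forall>g\<in>l2. l2_inner (q f) g = l2_inner f (q g))"

definition rho_comb :: "'g::group_add set \<Rightarrow> ('g \<Rightarrow> complex) \<Rightarrow> ('g \<Rightarrow> complex) \<Rightarrow> ('g \<Rightarrow> complex)" where
  "rho_comb A c f = (\<lambda>x. \<Sum>g\<in>A. c g * rho g f x)"

text \<open>The right group von Neumann algebra R(Gamma): the weak-operator-topology closure of
  span {rho(g)} within the bounded operators on l2 (basic WOT neighbourhoods are given by
  finitely many pairs of vectors and an epsilon).\<close>
definition vN_R :: "(('g::group_add \<Rightarrow> complex) \<Rightarrow> ('g \<Rightarrow> complex)) set" where
  "vN_R = {T. bounded_op_l2 T \<and>
     (\<forall>P \<epsilon>. finite P \<longrightarrow> P \<subseteq> l2 \<times> l2 \<longrightarrow> \<epsilon> > 0 \<longrightarrow>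
        (\<exists>A c. finite A \<and> (\<forall>(f, h)\<in>P.
            cmod (l2_inner (T f) h - l2_inner (rho_comb A c f) h) < \<epsilon>)))}"

text \<open>Elements of L^2(R(Gamma)) are the (in general unbounded) operators
  sum_g c(g) rho(g), c in l2, affiliated to R(Gamma).  We represent each one by its action on
  the common core of finitely supported vectors (where the sum is finite); off this core
  the representing function is 0.\<close>
definition fin_supp :: "('g \<Rightarrow> complex) \<Rightarrow> bool" where
  "fin_supp h \<longleftrightarrow> finite {x. h x \<noteq> 0}"

definition op_series :: "('g::group_add \<Rightarrow> complex) \<Rightarrow> (('g \<Rightarrow> complex) \<Rightarrow> ('g \<Rightarrow> complex))" where
  "op_series c = (\<lambda>h. if fin_supp h then (\<lambda>x. \<Sum>\<^sub>\<infinity>g. c g * rho g h x) else (\<lambda>x. 0))"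

definition L2R :: "(('g::group_add \<Rightarrow> complex) \<Rightarrow> ('g \<Rightarrow> complex)) set" where
  "L2R = {op_series c | c. c \<in> l2}"

definition fourier :: "('g::group_add \<Rightarrow> complex) \<Rightarrow> (('g \<Rightarrow> complex) \<Rightarrow> ('g \<Rightarrow> complex))" where
  "fourier f = (\<lambda>h. if fin_supp h then (\<lambda>x. \<Sum>\<^sub>\<infinity>g. f g * rho_adj g h x) else (\<lambda>x. 0))"

definition qL2R :: "(('g::group_add \<Rightarrow> complex) \<Rightarrow> ('g \<Rightarrow> complex)) \<Rightarrow> (('g \<Rightarrow> complex) \<Rightarrow> ('g \<Rightarrow> complex)) set" where
  "qL2R q = {(\<lambda>h. if fin_supp h then q (F h) else (\<lambda>x. 0)) | F. F \<in> L2R}"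

definition proj_l2 :: "('g \<Rightarrow> complex) set \<Rightarrow> ('g \<Rightarrow> complex) \<Rightarrow> ('g \<Rightarrow> complex)" where
  "proj_l2 V f = (THE v. v \<in> V \<and> (\<forall>w\<in>V. l2_inner (\<lambda>x. f x - v x) w = 0))"

end

theory Submission
  imports Defs
begin

text \<open>Since \<open>fourier f h\<close> is the finite combination of the translates \<open>lam y f\<close> with coefficients
  \<open>h y\<close>, an operator \<open>q\<close> that commutes with the left translations satisfies
  \<open>qL2R q = fourier ` q ` l2\<close>, so that \<open>fourier ` V = qL2R q\<close> means \<open>q ` l2 = V\<close>. Elements of
  \<open>vN_R\<close> commute with left translations because weak limits do. The converse needed for
  (i) \<open>\<Longrightarrow>\<close> (ii), that the projection onto a left-invariant \<open>V\<close> lies in \<open>vN_R\<close>, is a double commutant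
  argument: stack the finitely many test vectors into one vector \<open>F\<close> of an amplified space
  over \<open>\<Gamma> \<times> I\<close> and let \<open>K\<close> be the closed span of its right translates. The projection onto \<open>K\<close>
  commutes with the amplified projection onto \<open>V\<close>, so the latter maps \<open>F\<close> into \<open>K\<close>, which is
  approximation by combinations of right translations at all test vectors simultaneously.\<close>

section \<open>The Hilbert space of square summable functions\<close>

text \<open>Sums of nonnegative terms are suprema of their finite partial sums. This turns
  membership and norm bounds into uniform estimates for \<open>L2_set\<close>, so finite-dimensional
  inequalities and pointwise limits carry over to \<open>l2\<close>.\<close>

lemma l2_bound_iff:
  assumes "0 \<le> B"
  shows "(f \<in> l2 \<and> l2_norm f \<le> B) \<longleftrightarrow> (\<forall>F. finite F \<longrightarrow> L2_set (\<lambda>x. cmod (f x)) F \<le> B)"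
proof
  assume f: "f \<in> l2 \<and> l2_norm f \<le> B"
  show "\<forall>F. finite F \<longrightarrow> L2_set (\<lambda>x. cmod (f x)) F \<le> B"
  proof (intro allI impI)
    fix F :: "'a set" assume "finite F"
    then have "(\<Sum>x\<in>F. (cmod (f x))\<^sup>2) \<le> (\<Sum>\<^sub>\<infinity>x. (cmod (f x))\<^sup>2)"
      using f by (intro finite_sum_le_infsum) (auto simp: l2_def)
    then have "L2_set (\<lambda>x. cmod (f x)) F \<le> l2_norm f"
      unfolding L2_set_def l2_norm_def by (rule real_sqrt_le_mono)
    with f show "L2_set (\<lambda>x. cmod (f x)) F \<le> B" by linarith
  qed
next
  assume *: "\<forall>F. finite F \<longrightarrow> L2_set (\<lambda>x. cmod (f x)) F \<le> B"
  have b: "(\<Sum>x\<in>F. (cmod (f x))\<^sup>2) \<le> B\<^sup>2" if "finite F" for F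
    using * that by (auto simp: L2_set_def intro: sqrt_le_D)
  have s: "(\<lambda>x. (cmod (f x))\<^sup>2) summable_on UNIV"
    by (rule nonneg_bdd_above_summable_on) (use b in \<open>auto intro!: bdd_aboveI[of _ "B\<^sup>2"]\<close>)
  moreover have "(\<Sum>\<^sub>\<infinity>x. (cmod (f x))\<^sup>2) \<le> B\<^sup>2"
    by (rule infsum_le_finite_sums[OF s]) (use b in auto)
  ultimately show "f \<in> l2 \<and> l2_norm f \<le> B"
    using assms by (simp add: l2_def l2_norm_def real_le_lsqrt infsum_nonneg)
qed

lemma l2_norm_nonneg: "0 \<le> l2_norm f"
  by (simp add: l2_norm_def infsum_nonneg)

lemma L2_set_le_l2_norm: "f \<in> l2 \<Longrightarrow> finite F \<Longrightarrow> L2_set (\<lambda>x. cmod (f x)) F \<le> l2_norm f"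
  using l2_bound_iff[of "l2_norm f" f] l2_norm_nonneg by blast

lemma l2_norm_square: "(l2_norm f)\<^sup>2 = (\<Sum>\<^sub>\<infinity>x. (cmod (f x))\<^sup>2)"
  by (simp add: l2_norm_def infsum_nonneg)

lemma cmod_le_l2_norm: "f \<in> l2 \<Longrightarrow> cmod (f x) \<le> l2_norm f"
  using L2_set_le_l2_norm[of f "{x}"] by simp

lemma l2_add_and_norm:
  assumes "f \<in> l2" "g \<in> l2"
  shows "(\<lambda>x. f x + g x) \<in> l2 \<and> l2_norm (\<lambda>x. f x + g x) \<le> l2_norm f + l2_norm g"
proof (subst l2_bound_iff)
  \<comment> \<open>Minkowski's inequality on each finite set, with a bound independent of the
    set.\<close>
  show "\<forall>F. finite F \<longrightarrow> L2_set (\<lambda>x. cmod (f x + g x)) F \<le> l2_norm f + l2_norm g"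
  proof (intro allI impI)
    fix F :: "'a set" assume F: "finite F"
    have "L2_set (\<lambda>x. cmod (f x + g x)) F \<le> L2_set (\<lambda>x. cmod (f x) + cmod (g x)) F"
      by (rule L2_set_mono) (auto simp: norm_triangle_ineq)
    also have "\<dots> \<le> L2_set (\<lambda>x. cmod (f x)) F + L2_set (\<lambda>x. cmod (g x)) F"
      by (rule L2_set_triangle_ineq)
    also have "\<dots> \<le> l2_norm f + l2_norm g"
      by (intro add_mono L2_set_le_l2_norm assms F)
    finally show "L2_set (\<lambda>x. cmod (f x + g x)) F \<le> l2_norm f + l2_norm g" .
  qed
qed (simp add: l2_norm_nonneg)

lemmas l2_add = l2_add_and_norm[THEN conjunct1]
  and l2_norm_triangle = l2_add_and_norm[THEN conjunct2]

lemma l2_scale: "f \<in> l2 \<Longrightarrow> (\<lambda>x. c * f x) \<in> l2"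
  by (auto simp: l2_def norm_mult power_mult_distrib intro: summable_on_cmult_right)

lemma l2_norm_scale: "l2_norm (\<lambda>x. c * f x) = cmod c * l2_norm f"
  by (simp add: l2_norm_def norm_mult power_mult_distrib infsum_cmult_right' real_sqrt_mult)

lemma l2_zero: "(\<lambda>x. 0) \<in> l2"
  by (simp add: l2_def)

lemma l2_diff:
  assumes "f \<in> l2" "g \<in> l2"
  shows "(\<lambda>x. f x - g x) \<in> l2"
  using l2_add[OF assms(1) l2_scale[OF assms(2), of "-1"]] by simp

lemma l2_norm_diff_triangle:
  assumes "f \<in> l2" "g \<in> l2" "h \<in> l2"
  shows "l2_norm (\<lambda>x. f x - h x) \<le> l2_norm (\<lambda>x. f x - g x) + l2_norm (\<lambda>x. g x - h x)"
  using l2_norm_triangle[OF l2_diff[OF assms(1,2)] l2_diff[OF assms(2,3)]] by simp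

lemma l2_sum:
  assumes "\<And>a. a \<in> A \<Longrightarrow> f a \<in> l2"
  shows "(\<lambda>x. \<Sum>a\<in>A. f a x) \<in> l2"
  using assms by (induction A rule: infinite_finite_induct) (auto simp: l2_zero l2_add)

section \<open>The inner product and the Cauchy-Schwarz inequality\<close>

lemma l2_inner_bound:
  assumes "f \<in> l2" "g \<in> l2"
  shows "(\<lambda>x. cmod (f x * cnj (g x))) summable_on UNIV \<and> cmod (l2_inner f g) \<le> l2_norm f * l2_norm g"
proof -
  \<comment> \<open>This one estimate does double duty: boundedness gives absolute summability, and
    passing to the supremum gives the inequality.\<close>
  have b: "(\<Sum>x\<in>F. cmod (f x * cnj (g x))) \<le> l2_norm f * l2_norm g" if F: "finite F" for F
  proof -
    have "(\<Sum>x\<in>F. cmod (f x * cnj (g x))) = (\<Sum>x\<in>F. \<bar>cmod (f x)\<bar> * \<bar>cmod (g x)\<bar>)"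
      by (simp add: norm_mult)
    also have "\<dots> \<le> L2_set (\<lambda>x. cmod (f x)) F * L2_set (\<lambda>x. cmod (g x)) F"
      by (rule L2_set_mult_ineq)
    also have "\<dots> \<le> l2_norm f * l2_norm g"
      by (intro mult_mono L2_set_le_l2_norm assms F L2_set_nonneg l2_norm_nonneg)
    finally show ?thesis .
  qed
  have s: "(\<lambda>x. cmod (f x * cnj (g x))) summable_on UNIV"
    by (rule nonneg_bdd_above_summable_on) (use b in \<open>auto intro!: bdd_aboveI\<close>)
  have "cmod (l2_inner f g) \<le> (\<Sum>\<^sub>\<infinity>x. cmod (f x * cnj (g x)))"
    unfolding l2_inner_def using s by (rule norm_infsum_bound)
  also have "\<dots> \<le> l2_norm f * l2_norm g"
    by (rule infsum_le_finite_sums[OF s]) (use b in auto)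
  finally show ?thesis using s by simp
qed

lemmas cauchy_schwarz_l2 = l2_inner_bound[THEN conjunct2]

lemma l2_inner_summable: "f \<in> l2 \<Longrightarrow> g \<in> l2 \<Longrightarrow> (\<lambda>x. f x * cnj (g x)) summable_on UNIV"
  using l2_inner_bound by (blast intro: abs_summable_summable)

lemma l2_inner_add_left:
  "f \<in> l2 \<Longrightarrow> g \<in> l2 \<Longrightarrow> h \<in> l2 \<Longrightarrow> l2_inner (\<lambda>x. f x + g x) h = l2_inner f h + l2_inner g h"
  unfolding l2_inner_def distrib_right by (intro infsum_add l2_inner_summable)

lemma l2_inner_scale_left: "l2_inner (\<lambda>x. c * f x) h = c * l2_inner f h"
  by (simp add: l2_inner_def mult.assoc infsum_cmult_right')

lemma l2_inner_diff_left:
  "f \<in> l2 \<Longrightarrow> g \<in> l2 \<Longrightarrow> h \<in> l2 \<Longrightarrow> l2_inner (\<lambda>x. f x - g x) h = l2_inner f h - l2_inner g h"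
  using l2_inner_add_left[of f "\<lambda>x. (-1) * g x" h] l2_inner_scale_left[of "-1" g h] l2_scale[of g "-1"]
  by simp

lemma l2_inner_commute: "l2_inner g f = cnj (l2_inner f g)"
  by (simp add: l2_inner_def mult.commute flip: infsum_cnj)

lemma l2_inner_diff_right:
  "f \<in> l2 \<Longrightarrow> g \<in> l2 \<Longrightarrow> h \<in> l2 \<Longrightarrow> l2_inner h (\<lambda>x. f x - g x) = l2_inner h f - l2_inner h g"
  by (simp add: l2_inner_commute[of h] l2_inner_diff_left)

text \<open>The real family and its complex image are summable together, so the embedding of the
  reals passes through the infinite sum.\<close>

lemma l2_inner_self: "l2_inner f f = of_real ((l2_norm f)\<^sup>2)"
proof -
  have "(\<Sum>\<^sub>\<infinity>x. complex_of_real ((cmod (f x))\<^sup>2)) = of_real (\<Sum>\<^sub>\<infinity>x. (cmod (f x))\<^sup>2)"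
    by (rule infsum_bounded_linear_strong)
       (auto intro: bounded_linear_of_real summable_on_of_real dest: summable_on_Re simp del: of_real_power)
  then show ?thesis
    by (simp only: l2_inner_def l2_norm_square complex_norm_square)
qed

lemma l2_inner_self_eq_0:
  assumes "f \<in> l2" "l2_inner f f = 0"
  shows "f x = 0"
  using assms cmod_le_l2_norm[of f x] by (simp add: l2_inner_self)

lemma l2_norm_diff_square:
  assumes "f \<in> l2" "g \<in> l2"
  shows "(l2_norm (\<lambda>x. f x - g x))\<^sup>2 = (l2_norm f)\<^sup>2 - 2 * Re (l2_inner f g) + (l2_norm g)\<^sup>2"
proof -
  have "complex_of_real ((l2_norm (\<lambda>x. f x - g x))\<^sup>2)
      = l2_inner f f - l2_inner f g - (cnj (l2_inner f g) - l2_inner g g)"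
    using assms by (simp add: l2_inner_diff_left l2_inner_diff_right l2_diff l2_inner_commute[of g f]
        flip: l2_inner_self del: of_real_power)
  then have "Re (complex_of_real ((l2_norm (\<lambda>x. f x - g x))\<^sup>2))
      = Re (l2_inner f f - l2_inner f g - (cnj (l2_inner f g) - l2_inner g g))" by (rule arg_cong)
  then show ?thesis by (simp add: l2_inner_self del: of_real_power)
qed

text \<open>Expanding the squared norm for \<open>g\<close> and for \<open>-g\<close> makes the
  mixed terms cancel.\<close>

lemma l2_parallelogram:
  assumes "f \<in> l2" "g \<in> l2"
  shows "(l2_norm (\<lambda>x. f x + g x))\<^sup>2 + (l2_norm (\<lambda>x. f x - g x))\<^sup>2 = 2 * (l2_norm f)\<^sup>2 + 2 * (l2_norm g)\<^sup>2"
  using l2_norm_diff_square[OF assms] l2_norm_diff_square[OF assms(1) l2_scale[OF assms(2), of "-1"]]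
    l2_norm_scale[of "-1" g] l2_inner_scale_left[of "-1" g f]
  by (simp add: l2_inner_commute[of f])

text \<open>Evaluation at a point is bounded by the norm, so a Cauchy sequence converges pointwise;
  the pointwise limit is then shown to be the norm limit.\<close>

lemma l2_complete:
  fixes s :: "nat \<Rightarrow> 'a \<Rightarrow> complex"
  assumes s: "\<And>n. s n \<in> l2"
    and cauchy: "\<And>e. e > 0 \<Longrightarrow> \<exists>N. \<forall>m\<ge>N. \<forall>n\<ge>N. l2_norm (\<lambda>x. s m x - s n x) < e"
  obtains f where "f \<in> l2" "(\<lambda>n. l2_norm (\<lambda>x. s n x - f x)) \<longlonglongrightarrow> 0"
proof -
  have "Cauchy (\<lambda>n. s n x)" for x
  proof (rule metric_CauchyI)
    fix e :: real assume "e > 0"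
    from cauchy[OF this] obtain N where N: "\<forall>m\<ge>N. \<forall>n\<ge>N. l2_norm (\<lambda>x. s m x - s n x) < e" by blast
    show "\<exists>M. \<forall>m\<ge>M. \<forall>n\<ge>M. dist (s m x) (s n x) < e"
    proof (intro exI[of _ N] allI impI)
      fix m n assume "m \<ge> N" "n \<ge> N"
      then show "dist (s m x) (s n x) < e"
        using N cmod_le_l2_norm[OF l2_diff[OF s[of m] s[of n]], of x] by (fastforce simp: dist_norm)
    qed
  qed
  then have "\<exists>l. (\<lambda>n. s n x) \<longlonglongrightarrow> l" for x
    using convergent_eq_Cauchy by blast
  then obtain f where f: "\<And>x. (\<lambda>n. s n x) \<longlonglongrightarrow> f x" by metis
  \<comment> \<open>For fixed \<open>n\<close> and finite \<open>F\<close>, letting \<open>m\<close>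
    tend to infinity keeps the bound \<open>e\<close>. By \<open>l2_bound_iff\<close> this yields
    membership of the difference in \<open>l2\<close> along with its norm bound.\<close>
  have lim: "\<exists>N. \<forall>n\<ge>N. (\<lambda>x. s n x - f x) \<in> l2 \<and> l2_norm (\<lambda>x. s n x - f x) \<le> e" if "e > 0" for e
  proof -
    from cauchy[OF that] obtain N where N: "\<forall>m\<ge>N. \<forall>n\<ge>N. l2_norm (\<lambda>x. s m x - s n x) < e" by blast
    show ?thesis
    proof (intro exI[of _ N] allI impI)
      fix n assume n: "n \<ge> N"
      show "(\<lambda>x. s n x - f x) \<in> l2 \<and> l2_norm (\<lambda>x. s n x - f x) \<le> e"
      proof (subst l2_bound_iff)
        show "\<forall>F. finite F \<longrightarrow> L2_set (\<lambda>x. cmod (s n x - f x)) F \<le> e"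
        proof (intro allI impI)
          fix F :: "'a set" assume F: "finite F"
          have "(\<lambda>m. L2_set (\<lambda>x. cmod (s n x - s m x)) F) \<longlonglongrightarrow> L2_set (\<lambda>x. cmod (s n x - f x)) F"
            unfolding L2_set_def by (intro tendsto_intros f)
          moreover have "L2_set (\<lambda>x. cmod (s n x - s m x)) F \<le> e" if "m \<ge> N" for m
            using L2_set_le_l2_norm[OF l2_diff[OF s[of n] s[of m]] F] N n that by fastforce
          ultimately show "L2_set (\<lambda>x. cmod (s n x - f x)) F \<le> e"
            by (intro LIMSEQ_le_const2) blast+
        qed
      qed (use that in simp)
    qed
  qed
  from lim[of 1] obtain N where "(\<lambda>x. s N x - f x) \<in> l2" by auto
  from l2_diff[OF s[of N] this] have "f \<in> l2" by simp
  moreover have "(\<lambda>n. l2_norm (\<lambda>x. s n x - f x)) \<longlonglongrightarrow> 0"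
  proof (rule LIMSEQ_I)
    fix r :: real assume "r > 0"
    with lim[of "r/2"] obtain N where "\<forall>n\<ge>N. l2_norm (\<lambda>x. s n x - f x) \<le> r/2" by auto
    with \<open>r > 0\<close> show "\<exists>no. \<forall>n\<ge>no. norm (l2_norm (\<lambda>x. s n x - f x) - 0) < r"
      by (intro exI[of _ N]) (fastforce simp: l2_norm_nonneg)
  qed
  ultimately show ?thesis using that by blast
qed

section \<open>Orthogonal projections\<close>

lemma closed_subspace_l2D:
  assumes "closed_subspace_l2 V"
  shows "f \<in> V \<Longrightarrow> f \<in> l2" "(\<lambda>x. 0) \<in> V"
    "f \<in> V \<Longrightarrow> g \<in> V \<Longrightarrow> (\<lambda>x. f x + g x) \<in> V"
    "f \<in> V \<Longrightarrow> (\<lambda>x. c * f x) \<in> V"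
    "f \<in> V \<Longrightarrow> g \<in> V \<Longrightarrow> (\<lambda>x. f x - g x) \<in> V"
    "(\<And>n. s n \<in> V) \<Longrightarrow> f \<in> l2 \<Longrightarrow> (\<lambda>n. l2_norm (\<lambda>x. s n x - f x)) \<longlonglongrightarrow> 0 \<Longrightarrow> f \<in> V"
proof -
  show a: "f \<in> V \<Longrightarrow> g \<in> V \<Longrightarrow> (\<lambda>x. f x + g x) \<in> V"
    and m: "f \<in> V \<Longrightarrow> (\<lambda>x. c * f x) \<in> V" for f g c
    using assms unfolding closed_subspace_l2_def by blast+
  show "f \<in> V \<Longrightarrow> g \<in> V \<Longrightarrow> (\<lambda>x. f x - g x) \<in> V"
    using a[of f "\<lambda>x. (-1) * g x"] m[of g "-1"] by simp
qed (use assms in \<open>unfold closed_subspace_l2_def, blast+\<close>)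

text \<open>A minimizing sequence for the distance from \<open>f\<close> to \<open>V\<close> is
  Cauchy by the parallelogram law, and its limit stays in \<open>V\<close> because \<open>V\<close>
  is closed.\<close>

lemma l2_minimizer_exists:
  assumes V: "closed_subspace_l2 V" and f: "f \<in> l2"
  obtains v where "v \<in> V" "\<And>w. w \<in> V \<Longrightarrow> (l2_norm (\<lambda>x. f x - v x))\<^sup>2 \<le> (l2_norm (\<lambda>x. f x - w x))\<^sup>2"
proof -
  note VD = closed_subspace_l2D[OF V]
  define D where "D = (\<lambda>v. (l2_norm (\<lambda>x. f x - v x))\<^sup>2) ` V"
  define d where "d = Inf D"
  have bdd: "bdd_below D" by (auto simp: D_def intro!: bdd_belowI2[of _ 0])
  have d_le: "d \<le> (l2_norm (\<lambda>x. f x - v x))\<^sup>2" if "v \<in> V" for v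
    unfolding d_def using that by (intro cInf_lower bdd) (auto simp: D_def)
  have "\<exists>v\<in>V. (l2_norm (\<lambda>x. f x - v x))\<^sup>2 < d + inverse (real (Suc n))" for n
  proof -
    have "D \<noteq> {}" using VD(2) by (auto simp: D_def)
    then have "\<exists>y\<in>D. y < d + inverse (real (Suc n))"
      by (subst cInf_less_iff[OF _ bdd, symmetric]) (auto simp: d_def)
    then show ?thesis by (auto simp: D_def)
  qed
  then obtain s where s: "\<And>n. s n \<in> V"
    and sd: "\<And>n. (l2_norm (\<lambda>x. f x - s n x))\<^sup>2 < d + inverse (real (Suc n))" by metis
  have sl: "s n \<in> l2" for n using s VD(1) by blast
  \<comment> \<open>The midpoint of \<open>s n\<close> and \<open>s m\<close> lies in
    \<open>V\<close>, so its squared distance from \<open>f\<close> is at least \<open>d\<close>;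
    the parallelogram law leaves only the two errors for the difference.\<close>
  have dist: "(l2_norm (\<lambda>x. s m x - s n x))\<^sup>2 \<le> 2 * inverse (real (Suc m)) + 2 * inverse (real (Suc n))" for m n
  proof -
    have "(l2_norm (\<lambda>x. (f x - s n x) + (f x - s m x)))\<^sup>2 + (l2_norm (\<lambda>x. (f x - s n x) - (f x - s m x)))\<^sup>2
        = 2 * (l2_norm (\<lambda>x. f x - s n x))\<^sup>2 + 2 * (l2_norm (\<lambda>x. f x - s m x))\<^sup>2"
      by (intro l2_parallelogram l2_diff f sl)
    moreover have "(\<lambda>x. (f x - s n x) + (f x - s m x)) = (\<lambda>x. 2 * (f x - (1/2) * (s n x + s m x)))"
      by (simp add: algebra_simps)
    then have "(l2_norm (\<lambda>x. (f x - s n x) + (f x - s m x)))\<^sup>2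
        = 4 * (l2_norm (\<lambda>x. f x - (1/2) * (s n x + s m x)))\<^sup>2"
      by (simp only: l2_norm_scale power_mult_distrib) simp
    moreover have "l2_norm (\<lambda>x. (f x - s n x) - (f x - s m x)) = l2_norm (\<lambda>x. s m x - s n x)"
      by simp
    moreover have "d \<le> (l2_norm (\<lambda>x. f x - (1/2) * (s n x + s m x)))\<^sup>2"
      by (intro d_le VD(3,4) s)
    ultimately show ?thesis
      using sd[of n] sd[of m] by (smt (verit))
  qed
  obtain v where v: "v \<in> l2" and lim: "(\<lambda>n. l2_norm (\<lambda>x. s n x - v x)) \<longlonglongrightarrow> 0"
  proof (rule l2_complete[OF sl])
    fix e :: real assume "e > 0"
    \<comment> \<open>With this tolerance each of the two terms in \<open>dist\<close> contributes
      less than half of the square of \<open>e\<close>.\<close>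
    then have "e\<^sup>2 / 4 > 0" by simp
    from reals_Archimedean[OF this] obtain N where N: "inverse (real (Suc N)) < e\<^sup>2 / 4" by blast
    show "\<exists>N. \<forall>m\<ge>N. \<forall>n\<ge>N. l2_norm (\<lambda>x. s m x - s n x) < e"
    proof (intro exI[of _ N] allI impI)
      fix m n assume "m \<ge> N" "n \<ge> N"
      then have "inverse (real (Suc m)) \<le> inverse (real (Suc N))" "inverse (real (Suc n)) \<le> inverse (real (Suc N))"
        by (auto intro!: le_imp_inverse_le)
      with dist[of m n] N have "(l2_norm (\<lambda>x. s m x - s n x))\<^sup>2 < e\<^sup>2" by linarith
      then show "l2_norm (\<lambda>x. s m x - s n x) < e"
        using \<open>e > 0\<close> by (rule power2_less_imp_less[OF _ less_imp_le])
    qed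
  qed auto
  have "v \<in> V" using VD(6)[OF s v lim] .
  moreover have "(l2_norm (\<lambda>x. f x - v x))\<^sup>2 \<le> d"
  proof -
    have "l2_norm (\<lambda>x. f x - v x) \<le> sqrt (d + inverse (real (Suc n))) + l2_norm (\<lambda>x. s n x - v x)" for n
      using l2_norm_diff_triangle[OF f sl[of n] v] real_le_rsqrt[OF less_imp_le[OF sd[of n]]] by linarith
    moreover have "(\<lambda>n. sqrt (d + inverse (real (Suc n))) + l2_norm (\<lambda>x. s n x - v x)) \<longlonglongrightarrow> sqrt (d + 0) + 0"
      by (intro tendsto_intros lim LIMSEQ_inverse_real_of_nat)
    ultimately have "l2_norm (\<lambda>x. f x - v x) \<le> sqrt (d + 0) + 0"
      by (intro LIMSEQ_le_const) auto
    moreover have "d \<ge> 0" unfolding d_def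
      using VD(2) by (intro cInf_greatest) (auto simp: D_def)
    ultimately show ?thesis
      using sqrt_ge_absD[of "l2_norm (\<lambda>x. f x - v x)" d] l2_norm_nonneg[of "\<lambda>x. f x - v x"] by simp
  qed
  ultimately show ?thesis using that d_le by force
qed

text \<open>First variation: if the residual had a component along \<open>w\<close>, moving
  \<open>v\<close> slightly in that direction would bring it closer to \<open>f\<close>.\<close>

lemma l2_minimizer_orthogonal:
  assumes V: "closed_subspace_l2 V" and f: "f \<in> l2" and v: "v \<in> V"
    and min: "\<And>w. w \<in> V \<Longrightarrow> (l2_norm (\<lambda>x. f x - v x))\<^sup>2 \<le> (l2_norm (\<lambda>x. f x - w x))\<^sup>2"
    and w: "w \<in> V"
  shows "l2_inner (\<lambda>x. f x - v x) w = 0"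
proof (rule ccontr)
  note VD = closed_subspace_l2D[OF V]
  define r where "r = (\<lambda>x. f x - v x)"
  define a where "a = l2_inner r w"
  \<comment> \<open>The step \<open>c = e * a\<close> changes the squared distance by
    \<open>e * (cmod a)\<^sup>2 * (e * (l2_norm w)\<^sup>2 - 2)\<close>, so
    \<open>e * (l2_norm w)\<^sup>2 < 1\<close> makes it drop. The summand 1 keeps the denominator
    positive.\<close>
  define e where "e = 1 / (1 + (l2_norm w)\<^sup>2)"
  assume "l2_inner (\<lambda>x. f x - v x) w \<noteq> 0"
  then have a: "a \<noteq> 0" by (simp add: a_def r_def)
  have e: "e > 0" "e * (l2_norm w)\<^sup>2 < 1"
    by (auto simp: e_def add_pos_nonneg field_simps)
  have r: "r \<in> l2" unfolding r_def by (intro l2_diff f VD(1) v)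
  define c where "c = of_real e * a"
  have "(l2_norm r)\<^sup>2 \<le> (l2_norm (\<lambda>x. f x - (v x + c * w x)))\<^sup>2"
    unfolding r_def by (intro min VD(3,4) v w)
  also have "(\<lambda>x. f x - (v x + c * w x)) = (\<lambda>x. r x - c * w x)"
    by (simp add: r_def algebra_simps)
  also have "(l2_norm \<dots>)\<^sup>2 = (l2_norm r)\<^sup>2 - 2 * Re (l2_inner r (\<lambda>x. c * w x)) + (l2_norm (\<lambda>x. c * w x))\<^sup>2"
    by (intro l2_norm_diff_square r l2_scale VD(1) w)
  also have "l2_inner r (\<lambda>x. c * w x) = cnj c * a"
    by (simp add: l2_inner_commute[of r "\<lambda>x. c * w x"] l2_inner_scale_left a_def l2_inner_commute[of w r])
  also have "cnj c * a = of_real (e * (cmod a)\<^sup>2)"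
    unfolding c_def of_real_mult complex_norm_square by simp
  also have "(l2_norm (\<lambda>x. c * w x))\<^sup>2 = e\<^sup>2 * (cmod a)\<^sup>2 * (l2_norm w)\<^sup>2"
    by (simp add: l2_norm_scale c_def norm_mult power_mult_distrib)
  finally have "0 \<le> (e * (cmod a)\<^sup>2) * (e * (l2_norm w)\<^sup>2 - 2)"
    by (simp add: algebra_simps power2_eq_square)
  moreover have "e * (cmod a)\<^sup>2 > 0" using a e by simp
  ultimately show False using e(2) by (simp add: zero_le_mult_iff)
qed

text \<open>Two candidates differ by a vector of \<open>V\<close> orthogonal to \<open>V\<close>,
  hence to itself. Later identities for projections are obtained by checking this
  characterization.\<close>

lemma proj_l2_eqI:
  assumes V: "closed_subspace_l2 V" and f: "f \<in> l2" and v: "v \<in> V"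
    and o: "\<And>w. w \<in> V \<Longrightarrow> l2_inner (\<lambda>x. f x - v x) w = 0"
  shows "proj_l2 V f = v"
  unfolding proj_l2_def
proof (rule the_equality)
  note VD = closed_subspace_l2D[OF V]
  fix u assume u: "u \<in> V \<and> (\<forall>w\<in>V. l2_inner (\<lambda>x. f x - u x) w = 0)"
  define w where "w = (\<lambda>x. u x - v x)"
  have w: "w \<in> V" unfolding w_def using u v by (intro VD(3-5)) auto
  have "l2_inner w w = l2_inner (\<lambda>x. (f x - v x) - (f x - u x)) w"
    by (simp add: w_def)
  also have "\<dots> = 0"
    using u o[OF w] w v by (subst l2_inner_diff_left) (auto intro: l2_diff f VD(1))
  finally have "w x = 0" for x
    using l2_inner_self_eq_0[OF VD(1)[OF w]] by blast
  then show "u = v" by (auto simp: w_def fun_eq_iff)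
qed (use v o in auto)

lemma
  assumes V: "closed_subspace_l2 V" and f: "f \<in> l2"
  shows proj_l2_in: "proj_l2 V f \<in> V"
    and proj_l2_orthogonal: "w \<in> V \<Longrightarrow> l2_inner (\<lambda>x. f x - proj_l2 V f x) w = 0"
proof -
  obtain v where v: "v \<in> V" "\<And>w. w \<in> V \<Longrightarrow> (l2_norm (\<lambda>x. f x - v x))\<^sup>2 \<le> (l2_norm (\<lambda>x. f x - w x))\<^sup>2"
    using l2_minimizer_exists[OF V f] by blast
  note o = l2_minimizer_orthogonal[OF V f v]
  have "proj_l2 V f = v" by (rule proj_l2_eqI[OF V f v(1) o])
  with v(1) o show "proj_l2 V f \<in> V" "w \<in> V \<Longrightarrow> l2_inner (\<lambda>x. f x - proj_l2 V f x) w = 0" by auto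
qed

lemma proj_l2_in_l2: "closed_subspace_l2 V \<Longrightarrow> f \<in> l2 \<Longrightarrow> proj_l2 V f \<in> l2"
  by (rule closed_subspace_l2D(1)[OF _ proj_l2_in])

lemma proj_l2_fixes:
  assumes "closed_subspace_l2 V" "f \<in> V"
  shows "proj_l2 V f = f"
  using assms by (intro proj_l2_eqI closed_subspace_l2D(1)[OF assms(1)]) (auto simp: l2_inner_def)

lemma proj_l2_inner_left:
  assumes V: "closed_subspace_l2 V" and f: "f \<in> l2" and w: "w \<in> V"
  shows "l2_inner (proj_l2 V f) w = l2_inner f w"
  using proj_l2_orthogonal[OF V f w] proj_l2_in_l2[OF V f] closed_subspace_l2D(1)[OF V w]
  by (simp add: l2_inner_diff_left f)

text \<open>Both sides equal the inner product of the two projected vectors.\<close>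

lemma proj_l2_selfadjoint:
  assumes V: "closed_subspace_l2 V" and f: "f \<in> l2" and g: "g \<in> l2"
  shows "l2_inner (proj_l2 V f) g = l2_inner f (proj_l2 V g)"
proof -
  have "l2_inner (proj_l2 V f) g = l2_inner (proj_l2 V f) (proj_l2 V g)"
    using proj_l2_inner_left[OF V g proj_l2_in[OF V f]] by (metis l2_inner_commute)
  also have "\<dots> = l2_inner f (proj_l2 V g)"
    by (rule proj_l2_inner_left[OF V f proj_l2_in[OF V g]])
  finally show ?thesis .
qed

lemma proj_l2_linear:
  assumes V: "closed_subspace_l2 V" and f: "f \<in> l2" and g: "g \<in> l2"
  shows "proj_l2 V (\<lambda>x. a * f x + b * g x) = (\<lambda>x. a * proj_l2 V f x + b * proj_l2 V g x)"
proof (rule proj_l2_eqI[OF V])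
  note VD = closed_subspace_l2D[OF V]
  show "(\<lambda>x. a * f x + b * g x) \<in> l2" by (intro l2_add l2_scale f g)
  show "(\<lambda>x. a * proj_l2 V f x + b * proj_l2 V g x) \<in> V"
    by (intro VD(3,4) proj_l2_in V f g)
  fix w assume w: "w \<in> V"
  have "(\<lambda>x. a * f x + b * g x - (a * proj_l2 V f x + b * proj_l2 V g x))
      = (\<lambda>x. a * (f x - proj_l2 V f x) + b * (g x - proj_l2 V g x))"
    by (simp add: algebra_simps)
  then show "l2_inner (\<lambda>x. a * f x + b * g x - (a * proj_l2 V f x + b * proj_l2 V g x)) w = 0"
    using proj_l2_in_l2[OF V] proj_l2_orthogonal[OF V] f g w
    by (simp add: l2_inner_add_left l2_inner_scale_left l2_scale l2_diff VD(1))
qed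

text \<open>The squared norm of the projection is its inner product with \<open>f\<close>;
  Cauchy-Schwarz and cancelling one factor finish the estimate.\<close>

lemma proj_l2_norm_le:
  assumes V: "closed_subspace_l2 V" and f: "f \<in> l2"
  shows "l2_norm (proj_l2 V f) \<le> l2_norm f"
proof -
  let ?p = "proj_l2 V f"
  have "l2_inner f ?p = complex_of_real ((l2_norm ?p)\<^sup>2)"
    using proj_l2_inner_left[OF V f proj_l2_in[OF V f]] by (simp add: l2_inner_self)
  then have "(l2_norm ?p)\<^sup>2 = cmod (l2_inner f ?p)"
    by (simp add: norm_power)
  also have "\<dots> \<le> l2_norm f * l2_norm ?p"
    by (rule cauchy_schwarz_l2[OF f proj_l2_in_l2[OF V f]])
  finally have "l2_norm ?p * l2_norm ?p \<le> l2_norm f * l2_norm ?p"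
    by (simp add: power2_eq_square)
  then show ?thesis
    using l2_norm_nonneg[of ?p] l2_norm_nonneg[of f] by (cases "l2_norm ?p = 0") auto
qed

lemma orth_proj_l2_proj_l2:
  assumes V: "closed_subspace_l2 V"
  shows "orth_proj_l2 (proj_l2 V)"
  unfolding orth_proj_l2_def bounded_op_l2_def
proof (intro conjI ballI allI exI[of _ 1])
  fix f :: "'a \<Rightarrow> complex" assume f: "f \<in> l2"
  show "proj_l2 V (proj_l2 V f) = proj_l2 V f" by (intro proj_l2_fixes proj_l2_in V f)
  show "l2_norm (proj_l2 V f) \<le> 1 * l2_norm f" using proj_l2_norm_le[OF V f] by simp
qed (auto intro: proj_l2_in_l2 proj_l2_linear proj_l2_selfadjoint V)

text \<open>Idempotence makes \<open>q\<close> fix its range, and self-adjointness then makes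
  \<open>f - q f\<close> orthogonal to that range. This gives the identification of \<open>q\<close>
  in the last claim of the theorem.\<close>

lemma orth_proj_l2_eq_proj_l2:
  assumes q: "orth_proj_l2 q" and V: "closed_subspace_l2 V" "q ` l2 = V" and f: "f \<in> l2"
  shows "q f = proj_l2 V f"
proof (rule sym, rule proj_l2_eqI[OF V(1) f])
  show "q f \<in> V" using V f by auto
  fix w assume w: "w \<in> V"
  then obtain u where u: "u \<in> l2" "w = q u" using V by auto
  have ql: "q h \<in> l2" if "h \<in> l2" for h using q that by (auto simp: orth_proj_l2_def bounded_op_l2_def)
  have idem: "q (q h) = q h" if "h \<in> l2" for h using q that by (auto simp: orth_proj_l2_def)
  have "l2_inner (q f) w = l2_inner f (q w)"
    using q f ql[OF u(1)] u(2) by (auto simp: orth_proj_l2_def)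
  also have "q w = w" using u idem by simp
  finally show "l2_inner (\<lambda>x. f x - q f x) w = 0"
    using ql f u by (simp add: l2_inner_diff_left)
qed

section \<open>Norm closure of a linear subspace\<close>

lemma closed_subspace_l2_closure:
  assumes S: "S \<subseteq> l2" "(\<lambda>x. 0) \<in> S"
    "\<And>f g. f \<in> S \<Longrightarrow> g \<in> S \<Longrightarrow> (\<lambda>x. f x + g x) \<in> S" "\<And>c f. f \<in> S \<Longrightarrow> (\<lambda>x. c * f x) \<in> S"
  shows "closed_subspace_l2 {f \<in> l2. \<forall>e>0. \<exists>s\<in>S. l2_norm (\<lambda>x. s x - f x) < e}" (is "closed_subspace_l2 ?K")
  unfolding closed_subspace_l2_def
proof (intro conjI allI ballI impI)
  have SK: "f \<in> ?K" if "f \<in> S" for f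
    using that S(1) by (auto intro!: bexI[of _ f] simp: l2_norm_def)
  then show "(\<lambda>x. 0) \<in> ?K" using S(2) by blast
  fix f assume f: "f \<in> ?K"
  show "(\<lambda>x. c * f x) \<in> ?K" for c
  \<comment> \<open>The tolerance \<open>e / cmod c\<close> requires a nonzero scalar; for
    \<open>c = 0\<close> the product is the zero vector.\<close>
  proof (cases "c = 0")
    case False
    have "\<exists>s\<in>S. l2_norm (\<lambda>x. s x - c * f x) < e" if "e > 0" for e
    proof -
      have "e / cmod c > 0" using that False by simp
      then obtain s where s: "s \<in> S" "l2_norm (\<lambda>x. s x - f x) < e / cmod c" using f by blast
      have "l2_norm (\<lambda>x. c * s x - c * f x) = cmod c * l2_norm (\<lambda>x. s x - f x)"
        by (simp flip: l2_norm_scale right_diff_distrib)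
      also have "\<dots> < e" using s False by (simp add: field_simps)
      finally show ?thesis by (intro bexI[OF _ S(4)[OF s(1)]])
    qed
    then show ?thesis using f by (simp add: l2_scale)
  qed (use \<open>(\<lambda>x. 0) \<in> ?K\<close> in simp)
  fix g assume g: "g \<in> ?K"
  have "\<exists>s\<in>S. l2_norm (\<lambda>x. s x - (f x + g x)) < e" if "e > 0" for e
  proof -
    have "e / 2 > 0" using that by simp
    then obtain s t where s: "s \<in> S" "l2_norm (\<lambda>x. s x - f x) < e / 2"
      and t: "t \<in> S" "l2_norm (\<lambda>x. t x - g x) < e / 2" using f g by blast
    have "l2_norm (\<lambda>x. (s x - f x) + (t x - g x)) \<le> l2_norm (\<lambda>x. s x - f x) + l2_norm (\<lambda>x. t x - g x)"
      using s t f g S(1) by (intro l2_norm_triangle l2_diff) auto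
    also have "\<dots> < e" using s t by simp
    finally have "l2_norm (\<lambda>x. (s x + t x) - (f x + g x)) < e" by (simp add: algebra_simps)
    then show ?thesis by (intro bexI[OF _ S(3)[OF s(1) t(1)]])
  qed
  then show "(\<lambda>x. f x + g x) \<in> ?K" using f g by (simp add: l2_add)
next
  fix s :: "nat \<Rightarrow> 'a \<Rightarrow> complex" and f
  assume s: "\<forall>n. s n \<in> ?K" and f: "f \<in> l2" and lim: "(\<lambda>n. l2_norm (\<lambda>x. s n x - f x)) \<longlonglongrightarrow> 0"
  have "\<exists>t\<in>S. l2_norm (\<lambda>x. t x - f x) < e" if "e > 0" for e
  proof -
    have e: "e / 2 > 0" using that by simp
    from LIMSEQ_D[OF lim this] obtain n where "norm (l2_norm (\<lambda>x. s n x - f x) - 0) < e / 2" by blast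
    then have n: "l2_norm (\<lambda>x. s n x - f x) < e / 2" by simp
    from s e obtain t where t: "t \<in> S" "l2_norm (\<lambda>x. t x - s n x) < e / 2" by blast
    have "l2_norm (\<lambda>x. t x - f x) \<le> l2_norm (\<lambda>x. t x - s n x) + l2_norm (\<lambda>x. s n x - f x)"
      using s t f S(1) by (intro l2_norm_diff_triangle) auto
    also have "\<dots> < e" using n t by simp
    finally show ?thesis using t(1) by blast
  qed
  with f show "f \<in> ?K" by blast
qed auto

section \<open>Basis vectors and permutations of the index set\<close>

definition delta :: "'a \<Rightarrow> 'a \<Rightarrow> complex" where
  "delta a = (\<lambda>x. if x = a then 1 else 0)"

lemma delta_in_l2: "delta a \<in> l2"
proof -
  have "finite {x. (cmod (delta a x))\<^sup>2 \<noteq> 0}"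
    by (rule finite_subset[of _ "{a}"]) (auto simp: delta_def)
  then show ?thesis
    unfolding l2_def by (auto intro: finite_nonzero_values_imp_summable_on)
qed

lemma l2_inner_delta_right: "l2_inner f (delta a) = f a"
proof -
  have "l2_inner f (delta a) = (\<Sum>\<^sub>\<infinity>x\<in>{a}. f x)"
    unfolding l2_inner_def by (rule infsum_cong_neutral) (auto simp: delta_def)
  then show ?thesis by simp
qed

lemma l2_eqI: "(\<And>h. h \<in> l2 \<Longrightarrow> l2_inner f h = l2_inner g h) \<Longrightarrow> f = g"
  using l2_inner_delta_right delta_in_l2 by (metis ext)

lemma l2_reindex:
  assumes "bij \<phi>" "f \<in> l2"
  shows "(\<lambda>x. f (\<phi> x)) \<in> l2"
  using assms summable_on_reindex_bij_betw[of \<phi> UNIV UNIV "\<lambda>x. (cmod (f x))\<^sup>2"]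
  by (simp add: l2_def)

lemma l2_inner_reindex:
  assumes "\<And>x. \<phi> (\<psi> x) = x" "\<And>x. \<psi> (\<phi> x) = x"
  shows "l2_inner (\<lambda>x. f (\<phi> x)) g = l2_inner f (\<lambda>x. g (\<psi> x))"
  unfolding l2_inner_def
  by (rule infsum_reindex_bij_witness[of _ \<psi> \<phi>]) (simp_all add: assms)

text \<open>A permutation of the index set acts unitarily, with the inverse permutation as adjoint.
  Stability of \<open>V\<close> under both makes \<open>V\<close> a reducing subspace, so its
  projection commutes with the action.\<close>

lemma proj_l2_reindex:
  assumes V: "closed_subspace_l2 V" and f: "f \<in> l2"
    and inv: "\<And>x. \<phi> (\<psi> x) = x" "\<And>x. \<psi> (\<phi> x) = x"
    and stable: "\<And>w. w \<in> V \<Longrightarrow> (\<lambda>x. w (\<phi> x)) \<in> V" "\<And>w. w \<in> V \<Longrightarrow> (\<lambda>x. w (\<psi> x)) \<in> V"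
  shows "proj_l2 V (\<lambda>x. f (\<phi> x)) = (\<lambda>x. proj_l2 V f (\<phi> x))"
proof (rule proj_l2_eqI[OF V])
  show "(\<lambda>x. f (\<phi> x)) \<in> l2"
    by (rule l2_reindex[OF _ f]) (metis inv bijI')
  show "(\<lambda>x. proj_l2 V f (\<phi> x)) \<in> V" by (intro stable proj_l2_in V f)
  fix w assume w: "w \<in> V"
  show "l2_inner (\<lambda>x. f (\<phi> x) - proj_l2 V f (\<phi> x)) w = 0"
    using l2_inner_reindex[OF inv, of "\<lambda>x. f x - proj_l2 V f x" w] proj_l2_orthogonal[OF V f stable(2)[OF w]]
    by simp
qed

section \<open>Amplification to the product with an index set\<close>

lemma l2_slice:
  assumes "F \<in> l2"
  shows "(\<lambda>x. F (x, i)) \<in> l2" "l2_norm (\<lambda>x. F (x, i)) \<le> l2_norm F"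
proof -
  have "L2_set (\<lambda>x. cmod (F (x, i))) A \<le> l2_norm F" if "finite A" for A
  proof -
    have "L2_set (\<lambda>x. cmod (F (x, i))) A = L2_set (\<lambda>x. cmod (F x)) ((\<lambda>x. (x, i)) ` A)"
      unfolding L2_set_def by (subst sum.reindex) (auto simp: inj_on_def)
    then show ?thesis using L2_set_le_l2_norm[OF assms] that by simp
  qed
  then show "(\<lambda>x. F (x, i)) \<in> l2" "l2_norm (\<lambda>x. F (x, i)) \<le> l2_norm F"
    using l2_bound_iff[OF l2_norm_nonneg[of F], of "\<lambda>x. F (x, i)"] by auto
qed

text \<open>The inclusion of the \<open>i\<close>-th copy of the space into the direct sum of
  copies; it is adjoint to taking the \<open>i\<close>-th slice.\<close>

definition embed :: "'i \<Rightarrow> ('a \<Rightarrow> complex) \<Rightarrow> 'a \<times> 'i \<Rightarrow> complex" where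
  "embed i f = (\<lambda>(x, j). if j = i then f x else 0)"

lemma embed_apply [simp]: "embed i f (x, j) = (if j = i then f x else 0)"
  by (simp add: embed_def)

lemma embed_in_l2:
  assumes "f \<in> l2"
  shows "embed i f \<in> l2"
proof -
  have "(\<lambda>x. (cmod (embed i f x))\<^sup>2) summable_on UNIV
      \<longleftrightarrow> (\<lambda>x. (cmod (embed i f x))\<^sup>2) summable_on range (\<lambda>x. (x, i))"
    by (rule summable_on_cong_neutral) auto
  also have "\<dots> \<longleftrightarrow> (\<lambda>x. (cmod (f x))\<^sup>2) summable_on UNIV"
    by (subst summable_on_reindex) (auto simp: inj_on_def o_def)
  finally show ?thesis using assms by (simp add: l2_def)
qed

lemma l2_inner_embed_right: "l2_inner F (embed i f) = l2_inner (\<lambda>x. F (x, i)) f"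
proof -
  have "l2_inner F (embed i f) = (\<Sum>\<^sub>\<infinity>x\<in>range (\<lambda>x. (x, i)). F x * cnj (embed i f x))"
    unfolding l2_inner_def by (rule infsum_cong_neutral) (auto simp: embed_def split: if_splits)
  also have "\<dots> = l2_inner (\<lambda>x. F (x, i)) f"
    unfolding l2_inner_def by (subst infsum_reindex) (auto simp: inj_on_def o_def)
  finally show ?thesis .
qed

text \<open>The Hilbert space tensor product of \<open>V\<close> with the square summable functions
  on the index type. That type may be infinite, so \<open>F \<in> l2\<close> is a condition beyond
  that on the slices.\<close>

definition amplification :: "('a \<Rightarrow> complex) set \<Rightarrow> ('a \<times> 'i \<Rightarrow> complex) set" where
  "amplification V = {F \<in> l2. \<forall>i. (\<lambda>x. F (x, i)) \<in> V}"

lemma closed_subspace_l2_amplification: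
  assumes V: "closed_subspace_l2 V"
  shows "closed_subspace_l2 (amplification V)"
  unfolding closed_subspace_l2_def amplification_def
proof (safe intro!: l2_zero l2_add l2_scale)
  note VD = closed_subspace_l2D[OF V]
  show "(\<lambda>x. 0) \<in> V" by (rule VD(2))
  fix F :: "'a \<times> 'b \<Rightarrow> complex" and i
  assume F: "\<forall>i. (\<lambda>x. F (x, i)) \<in> V"
  then show "(\<lambda>x. c * F (x, i)) \<in> V" for c by (intro VD(3-5)) auto
  show "(\<lambda>x. F (x, i) + G (x, i)) \<in> V" if "\<forall>i. (\<lambda>x. G (x, i)) \<in> V" for G
    using F that by (intro VD(3-5)) auto
next
  note VD = closed_subspace_l2D[OF V]
  fix s :: "nat \<Rightarrow> 'a \<times> 'b \<Rightarrow> complex" and F i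
  assume s: "\<forall>n. s n \<in> {F \<in> l2. \<forall>i. (\<lambda>x. F (x, i)) \<in> V}" and F: "F \<in> l2"
    and lim: "(\<lambda>n. l2_norm (\<lambda>x. s n x - F x)) \<longlonglongrightarrow> 0"
  show "(\<lambda>x. F (x, i)) \<in> V"
  proof (rule VD(6))
    show "(\<lambda>x. s n (x, i)) \<in> V" for n using s by blast
    have "l2_norm (\<lambda>x. s n (x, i) - F (x, i)) \<le> l2_norm (\<lambda>x. s n x - F x)" for n
      using s F by (intro l2_slice(2)[of "\<lambda>x. s n x - F x"] l2_diff) auto
    then show "(\<lambda>n. l2_norm (\<lambda>x. s n (x, i) - F (x, i))) \<longlonglongrightarrow> 0"
      by (intro tendsto_sandwich[OF _ _ tendsto_const lim] always_eventually) (auto simp: l2_norm_nonneg)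
  qed (rule l2_slice[OF F])
qed

text \<open>Testing orthogonality in the amplified space against \<open>embed i w\<close> gives
  orthogonality of the \<open>i\<close>-th slice to \<open>w\<close>, so the projection acts slice
  by slice.\<close>

lemma proj_l2_amplification:
  assumes V: "closed_subspace_l2 V" and F: "F \<in> l2"
  shows "proj_l2 (amplification V) F (x, i) = proj_l2 V (\<lambda>x. F (x, i)) x"
proof -
  let ?W = "amplification V :: ('a \<times> 'b \<Rightarrow> complex) set" and ?Q = "proj_l2 (amplification V) F"
  note VD = closed_subspace_l2D[OF V]
  have W: "closed_subspace_l2 ?W" by (rule closed_subspace_l2_amplification[OF V])
  have "proj_l2 V (\<lambda>x. F (x, i)) = (\<lambda>x. ?Q (x, i))"
  proof (rule proj_l2_eqI[OF V l2_slice(1)[OF F]])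
    show "(\<lambda>x. ?Q (x, i)) \<in> V"
      using proj_l2_in[OF W F] by (auto simp: amplification_def)
    fix w assume w: "w \<in> V"
    have "(\<lambda>x. embed i w (x, j)) \<in> V" for j
      using w VD(2) by (cases "j = i") simp_all
    then have "embed i w \<in> ?W"
      by (simp add: amplification_def embed_in_l2 VD(1)[OF w] del: embed_apply)
    from proj_l2_orthogonal[OF W F this] show "l2_inner (\<lambda>x. F (x, i) - ?Q (x, i)) w = 0"
      by (simp add: l2_inner_embed_right)
  qed
  then show ?thesis by simp
qed

section \<open>The commutation theorem\<close>

lemma proj_l2_delta_hermitian:
  assumes V: "closed_subspace_l2 V"
  shows "proj_l2 V (delta a) b = cnj (proj_l2 V (delta b) a)"
  using proj_l2_selfadjoint[OF V delta_in_l2[of a] delta_in_l2[of b]]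
  by (simp add: l2_inner_delta_right l2_inner_commute[of "delta a"])

text \<open>By self-adjointness, \<open>comm\<close> compares the matrix coefficients of the two
  products. Testing against \<open>delta a\<close> and moving both projections across then reaches
  every \<open>f\<close>, without a density argument.\<close>

lemma proj_l2_commute:
  assumes V: "closed_subspace_l2 V" and W: "closed_subspace_l2 W"
    and comm: "\<And>a b. l2_inner (proj_l2 V (delta a)) (proj_l2 W (delta b))
        = l2_inner (proj_l2 W (delta a)) (proj_l2 V (delta b))"
    and f: "f \<in> l2"
  shows "proj_l2 V (proj_l2 W f) = proj_l2 W (proj_l2 V f)"
proof -
  note [simp] = proj_l2_in_l2[OF V] proj_l2_in_l2[OF W] delta_in_l2
  have eq: "proj_l2 V (proj_l2 W (delta b)) = proj_l2 W (proj_l2 V (delta b))" for b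
  proof
    fix a
    have "l2_inner (delta a) (proj_l2 V (proj_l2 W (delta b))) = l2_inner (delta a) (proj_l2 W (proj_l2 V (delta b)))"
      using comm[of a b] by (simp flip: proj_l2_selfadjoint[OF V] proj_l2_selfadjoint[OF W])
    then show "proj_l2 V (proj_l2 W (delta b)) a = proj_l2 W (proj_l2 V (delta b)) a"
      by (simp add: l2_inner_commute[of "delta a"] l2_inner_delta_right)
  qed
  show ?thesis
  proof
    fix a
    have "l2_inner (proj_l2 V (proj_l2 W f)) (delta a) = l2_inner (proj_l2 W (proj_l2 V f)) (delta a)"
      using eq[of a] by (simp add: proj_l2_selfadjoint[OF V] proj_l2_selfadjoint[OF W] f)
    then show "proj_l2 V (proj_l2 W f) a = proj_l2 W (proj_l2 V f) a"
      by (simp add: l2_inner_delta_right)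
  qed
qed

lemma proj_l2_lam:
  assumes V: "closed_subspace_l2 V" "left_invariant V" and f: "f \<in> l2"
  shows "proj_l2 V (lam g f) = lam g (proj_l2 V f)"
proof -
  have s: "(\<lambda>x. w (h + x)) \<in> V" if "w \<in> V" for h w
    using V(2) that minus_minus[of h] unfolding left_invariant_def lam_def by metis
  show ?thesis
    unfolding lam_def
    by (rule proj_l2_reindex[OF V(1) f, where \<psi> = "\<lambda>x. g + x"]) (auto simp: s add.assoc[symmetric])
qed

lemma proj_l2_right_translate:
  assumes K: "closed_subspace_l2 K" and inv: "\<And>g F. F \<in> K \<Longrightarrow> (\<lambda>(x, i). F (x + g, i)) \<in> K"
    and F: "F \<in> l2"
  shows "proj_l2 K (\<lambda>(x :: 'g :: group_add, i). F (x + g, i)) = (\<lambda>(x, i). proj_l2 K F (x + g, i))"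
  using proj_l2_reindex[OF K F, where \<phi> = "\<lambda>(x, i). (x + g, i)" and \<psi> = "\<lambda>(x, i). (x + - g, i)"]
    inv[of _ g] inv[of _ "- g"]
  by (simp add: case_prod_unfold add.assoc)

text \<open>On basis vectors, both orders of composition give the same convolution sum after a change of
  variables.\<close>
lemma proj_l2_amplification_commute:
  fixes V :: "('g :: group_add \<Rightarrow> complex) set" and K :: "('g \<times> 'i \<Rightarrow> complex) set"
  assumes V: "closed_subspace_l2 V" "left_invariant V"
    and K: "closed_subspace_l2 K" and inv: "\<And>g F. F \<in> K \<Longrightarrow> (\<lambda>(x, i). F (x + g, i)) \<in> K"
    and F: "F \<in> l2"
  shows "proj_l2 (amplification V) (proj_l2 K F) = proj_l2 K (proj_l2 (amplification V) F)"
proof (rule proj_l2_commute[OF closed_subspace_l2_amplification[OF V(1)] K _ F])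
  let ?W = "amplification V :: ('g \<times> 'i \<Rightarrow> complex) set"
  \<comment> \<open>By translation covariance, \<open>t\<close> determines the whole matrix of the
    projection onto \<open>V\<close>, and the vectors \<open>p i\<close> determine that of the
    projection onto \<open>K\<close>.\<close>
  define t where "t = proj_l2 V (delta 0)"
  define p where "p i = proj_l2 K (delta (0, i))" for i
  have q: "proj_l2 V (delta x) z = t (- x + z)" for x z
  proof -
    have "delta x = lam x (delta 0)"
      by (auto simp: delta_def lam_def fun_eq_iff neg_eq_iff_add_eq_0[of "- x", symmetric])
    then have "proj_l2 V (delta x) = lam x t"
      by (metis proj_l2_lam[OF V delta_in_l2] t_def)
    then show ?thesis by (simp add: lam_def)
  qed
  have Q: "proj_l2 ?W (delta (x, i)) = embed i (\<lambda>z. t (- x + z))" for x i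
  proof (rule ext, clarify)
    fix z j
    have "(\<lambda>z. delta (x, i) (z, j)) = (if j = i then delta x else (\<lambda>z. 0))"
      by (auto simp: delta_def)
    moreover have "proj_l2 V (\<lambda>z. 0) = (\<lambda>z. 0)"
      by (intro proj_l2_fixes V closed_subspace_l2D(2))
    ultimately show "proj_l2 ?W (delta (x, i)) (z, j) = embed i (\<lambda>z. t (- x + z)) (z, j)"
      by (simp add: proj_l2_amplification[OF V(1) delta_in_l2] q)
  qed
  have P: "proj_l2 K (delta (y, i)) (z, j) = p i (z - y, j)" for y i z j
  proof -
    have "delta (y, i) = (\<lambda>(x, k). delta (0, i) (x + - y, k))"
      by (auto simp: delta_def fun_eq_iff)
    then show ?thesis
      using proj_l2_right_translate[OF K inv delta_in_l2, of "(0, i)" "- y"] by (simp add: p_def)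
  qed
  \<comment> \<open>Hermitian symmetry of the two kernels removes the complex conjugates from the
    inner products below.\<close>
  have t_herm: "cnj (t (- x + z)) = t (- z + x)" for x z
    using proj_l2_delta_hermitian[OF V(1), of z x] by (simp add: q)
  have p_herm: "cnj (p j (z - y, i)) = p i (y - z, j)" for i j y z
    using proj_l2_delta_hermitian[OF K, of "(z, i)" "(y, j)"] by (simp add: P)
  fix a b :: "'g \<times> 'i"
  obtain x i y j where ab: "a = (x, i)" "b = (y, j)" by fastforce
  have "l2_inner (proj_l2 ?W (delta a)) (proj_l2 K (delta b))
      = cnj (l2_inner (proj_l2 K (delta b)) (proj_l2 ?W (delta a)))"
    by (rule l2_inner_commute)
  also have "\<dots> = (\<Sum>\<^sub>\<infinity>z. t (- x + z) * p i (y - z, j))"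
    by (simp add: ab Q l2_inner_embed_right P) (simp add: l2_inner_def p_herm mult.commute flip: infsum_cnj)
  also have "\<dots> = (\<Sum>\<^sub>\<infinity>z. p i (z - x, j) * t (- z + y))"
    \<comment> \<open>Substituting \<open>u = y - z + x\<close> gives \<open>u - x = y - z\<close>
      and \<open>- u + y = - x + z\<close>, in this order of the noncommuting terms.\<close>
    by (rule infsum_reindex_bij_witness[of _ "\<lambda>u. x - u + y" "\<lambda>z. y - z + x"])
       (simp_all add: minus_add add.assoc diff_conv_add_uminus del: add_uminus_conv_diff)
  also have "\<dots> = l2_inner (proj_l2 K (delta a)) (proj_l2 ?W (delta b))"
    by (simp add: ab Q l2_inner_embed_right P) (simp add: l2_inner_def t_herm)
  finally show "l2_inner (proj_l2 ?W (delta a)) (proj_l2 K (delta b))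
      = l2_inner (proj_l2 K (delta a)) (proj_l2 ?W (delta b))" .
qed

text \<open>The approximants are close in norm at each test vector \<open>f\<close>; pairing with
  \<open>h\<close> by Cauchy-Schwarz gives the weak estimate.\<close>

lemma left_invariant_proj_in_vN_R:
  fixes V :: "('g :: group_add \<Rightarrow> complex) set"
  assumes V: "closed_subspace_l2 V" "left_invariant V"
  shows "proj_l2 V \<in> vN_R"
  unfolding vN_R_def
proof (intro CollectI conjI allI impI)
  show "bounded_op_l2 (proj_l2 V)"
    using orth_proj_l2_proj_l2[OF V(1)] by (simp add: orth_proj_l2_def)
  fix P :: "(('g \<Rightarrow> complex) \<times> ('g \<Rightarrow> complex)) set" and \<epsilon> :: real
  assume P: "finite P" "P \<subseteq> l2 \<times> l2" and \<epsilon>: "\<epsilon> > 0"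
  \<comment> \<open>The pairs themselves index the copies: slice \<open>p\<close> of
    \<open>F\<close> is \<open>fst p\<close> for \<open>p \<in> P\<close>, and all other slices
    vanish.\<close>
  define F where "F = (\<lambda>x. \<Sum>p\<in>P. embed p (fst p) x)"
  have F: "F \<in> l2" unfolding F_def using P by (intro l2_sum embed_in_l2) auto
  have F_slice: "(\<lambda>x. F (x, p)) = fst p" if "p \<in> P" for p
    using P(1) that by (simp add: F_def)
  \<comment> \<open>The same combination of right translations acts on all slices at once, so
    \<open>S\<close> is the span of the right translates of \<open>F\<close>.\<close>
  define comb where "comb A c = (\<lambda>(x, i). \<Sum>g\<in>A. c g * F (x + g, i))" for A c
  define S where "S = {comb A c | A c. finite A}"
  have comb_l2: "comb A c \<in> l2" for A c
  proof -
    have "comb A c = (\<lambda>x. \<Sum>g\<in>A. c g * F (fst x + g, snd x))"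
      by (simp add: comb_def case_prod_unfold)
    moreover have "(\<lambda>x. F (fst x + g, snd x)) \<in> l2" for g
    proof -
      have "bij (\<lambda>x :: 'g \<times> _. (fst x + g, snd x))"
        by (rule bij_betw_byWitness[where f' = "\<lambda>x. (fst x - g, snd x)"]) auto
      from l2_reindex[OF this F] show ?thesis .
    qed
    ultimately show ?thesis by (simp add: l2_sum l2_scale)
  qed
  define K where "K = {f \<in> l2. \<forall>e>0. \<exists>s\<in>S. l2_norm (\<lambda>x. s x - f x) < e}"
  have K: "closed_subspace_l2 K"
    unfolding K_def
  proof (rule closed_subspace_l2_closure)
    show "S \<subseteq> l2" using comb_l2 by (auto simp: S_def)
    have "(\<lambda>x. 0) = comb {} (\<lambda>_. 0)" by (simp add: comb_def case_prod_unfold)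
    then show "(\<lambda>x. 0) \<in> S" by (auto simp: S_def)
    fix f assume "f \<in> S"
    then obtain A c where f: "f = comb A c" "finite A" by (auto simp: S_def)
    have "(\<lambda>x. a * f x) = comb A (\<lambda>g. a * c g)" for a
      by (auto simp: f comb_def sum_distrib_left mult.assoc)
    then show "(\<lambda>x. a * f x) \<in> S" for a using f(2) by (auto simp: S_def)
    fix h assume "h \<in> S"
    then obtain B d where h: "h = comb B d" "finite B" by (auto simp: S_def)
    \<comment> \<open>The coefficients are arbitrary off their index sets, so they are cut off
      before being added on the union.\<close>
    have "(\<lambda>x. f x + h x) = comb (A \<union> B) (\<lambda>g. (if g \<in> A then c g else 0) + (if g \<in> B then d g else 0))"
    proof (rule ext, clarify)
      fix x i
      have "(\<Sum>g\<in>A. c g * F (x + g, i)) = (\<Sum>g\<in>A \<union> B. (if g \<in> A then c g else 0) * F (x + g, i))"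
        "(\<Sum>g\<in>B. d g * F (x + g, i)) = (\<Sum>g\<in>A \<union> B. (if g \<in> B then d g else 0) * F (x + g, i))"
        using f(2) h(2) by (intro sum.mono_neutral_cong_left; auto)+
      then show "f (x, i) + h (x, i)
          = comb (A \<union> B) (\<lambda>g. (if g \<in> A then c g else 0) + (if g \<in> B then d g else 0)) (x, i)"
        by (simp add: f h comb_def distrib_right sum.distrib)
    qed
    then show "(\<lambda>x. f x + h x) \<in> S" using f(2) h(2) by (auto simp: S_def)
  qed
  have inv: "(\<lambda>(x, i). G (x + g, i)) \<in> K" if G: "G \<in> K" for g G
  proof -
    let ?\<phi> = "\<lambda>(x, i). (x + g, i)"
    have bij: "bij (?\<phi> :: 'g \<times> 'i \<Rightarrow> _)"
      by (rule bij_betw_byWitness[where f' = "\<lambda>(x, i). (x - g, i)"]) auto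
    have "(\<lambda>x. G (?\<phi> x)) \<in> l2" using G by (intro l2_reindex[OF bij]) (simp add: K_def)
    moreover have "\<exists>s\<in>S. l2_norm (\<lambda>x. s x - G (?\<phi> x)) < e" if "e > 0" for e
    proof -
      obtain A c where A: "finite A" and s: "l2_norm (\<lambda>x. comb A c x - G x) < e"
        using G \<open>e > 0\<close> by (auto simp: K_def S_def)
      \<comment> \<open>Translating by \<open>g\<close> turns \<open>x + k\<close> into
        \<open>x + (g + k)\<close>, so the index set moves to \<open>g + A\<close>.\<close>
      have "comb ((+) g ` A) (\<lambda>h. c (- g + h)) = (\<lambda>x. comb A c (?\<phi> x))"
        by (auto simp: comb_def sum.reindex add.assoc fun_eq_iff)
      moreover have "l2_norm (\<lambda>x. comb A c (?\<phi> x) - G (?\<phi> x)) = l2_norm (\<lambda>x. comb A c x - G x)"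
        unfolding l2_norm_def
        by (subst infsum_reindex_bij_betw[OF bij, of "\<lambda>x. (cmod (comb A c x - G x))\<^sup>2"]) simp
      ultimately have "l2_norm (\<lambda>x. comb ((+) g ` A) (\<lambda>h. c (- g + h)) x - G (?\<phi> x)) < e"
        using s by simp
      moreover have "comb ((+) g ` A) (\<lambda>h. c (- g + h)) \<in> S" using A by (auto simp: S_def)
      ultimately show ?thesis by blast
    qed
    ultimately show ?thesis by (simp add: K_def case_prod_unfold)
  qed
  let ?Q = "proj_l2 (amplification V)"
  have Q_l2: "?Q F \<in> l2"
    by (intro proj_l2_in_l2 closed_subspace_l2_amplification V F)
  have "F \<in> K"
  proof -
    have "F = comb {0} (\<lambda>_. 1)" by (simp add: comb_def)
    then have "F \<in> S" unfolding S_def by blast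
    then show ?thesis using F by (auto simp: K_def l2_norm_def intro!: bexI[of _ F])
  qed
  \<comment> \<open>Since \<open>F\<close> is fixed by the projection onto \<open>K\<close>,
    commutation puts \<open>?Q F\<close> into the range of that projection.\<close>
  then have "?Q F = proj_l2 K (?Q F)"
    using proj_l2_amplification_commute[OF V K inv F] by (simp add: proj_l2_fixes[OF K])
  then have "?Q F \<in> K"
    using proj_l2_in[OF K Q_l2] by simp
  \<comment> \<open>A common strict bound for the norms of all second components; the summand 1
    keeps it positive even when \<open>P\<close> is empty.\<close>
  moreover define C where "C = 1 + (\<Sum>p\<in>P. l2_norm (snd p))"
  have C: "l2_norm (snd p) < C" if "p \<in> P" for p
    using member_le_sum[of p P "\<lambda>p. l2_norm (snd p)"] P(1) that
    by (auto simp: C_def l2_norm_nonneg intro!: add_pos_nonneg sum_nonneg)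
  have C0: "C > 0"
    by (auto simp: C_def l2_norm_nonneg intro!: add_pos_nonneg sum_nonneg)
  ultimately have "\<exists>s\<in>S. l2_norm (\<lambda>x. s x - ?Q F x) < \<epsilon> / C"
    using \<epsilon> by (simp add: K_def)
  then obtain A c where A: "finite A" and s: "l2_norm (\<lambda>x. comb A c x - ?Q F x) < \<epsilon> / C"
    by (auto simp: S_def)
  have "cmod (l2_inner (proj_l2 V f) h - l2_inner (rho_comb A c f) h) < \<epsilon>" if fh: "(f, h) \<in> P" for f h
  proof -
    have fl: "f \<in> l2" and hl: "h \<in> l2" using P fh by auto
    have Qs: "(\<lambda>x. ?Q F (x, (f, h))) = proj_l2 V f"
      using F_slice[OF fh] by (simp add: proj_l2_amplification[OF V(1) F])
    have cs: "(\<lambda>x. comb A c (x, (f, h))) = rho_comb A c f"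
      using F_slice[OF fh] by (auto simp: comb_def rho_comb_def rho_def fun_eq_iff)
    have d: "(\<lambda>x. comb A c x - ?Q F x) \<in> l2" by (intro l2_diff comb_l2 Q_l2)
    let ?r = "\<lambda>x. rho_comb A c f x - proj_l2 V f x"
    have r: "?r \<in> l2" "l2_norm ?r < \<epsilon> / C"
      using l2_slice[OF d, of "(f, h)"] s fun_cong[OF Qs] fun_cong[OF cs] by auto
    have rl: "rho_comb A c f \<in> l2"
      using l2_slice(1)[OF comb_l2, of A c "(f, h)"] by (simp add: cs)
    have "cmod (l2_inner (proj_l2 V f) h - l2_inner (rho_comb A c f) h) = cmod (l2_inner ?r h)"
      using rl hl proj_l2_in_l2[OF V(1) fl] by (simp add: l2_inner_diff_left norm_minus_commute)
    also have "\<dots> \<le> l2_norm ?r * l2_norm h" by (rule cauchy_schwarz_l2[OF r(1) hl])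
    also have "\<dots> \<le> \<epsilon> / C * l2_norm h"
      using r(2) by (intro mult_right_mono l2_norm_nonneg) simp
    also have "\<dots> < \<epsilon> / C * C"
      using C[OF fh] \<epsilon> C0 by (intro mult_strict_left_mono) auto
    finally show ?thesis using C0 by simp
  qed
  with A show "\<exists>A c. finite A \<and> (\<forall>(f, h)\<in>P. cmod (l2_inner (proj_l2 V f) h - l2_inner (rho_comb A c f) h) < \<epsilon>)"
    by blast
qed

section \<open>The Fourier transform\<close>

lemma lam_in_l2: "f \<in> l2 \<Longrightarrow> lam g f \<in> l2"
  unfolding lam_def
  by (rule l2_reindex[OF bij_betw_byWitness[where f' = "\<lambda>x. g + x"]]) (auto simp: add.assoc[symmetric])

lemma l2_inner_lam: "l2_inner (lam g f) h = l2_inner f (lam (- g) h)"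
  unfolding lam_def by (rule l2_inner_reindex) (auto simp: add.assoc[symmetric])

lemma rho_comb_lam: "rho_comb A c (lam g f) = lam g (rho_comb A c f)"
  by (simp add: rho_comb_def lam_def rho_def add.assoc)

lemma vN_R_approx:
  assumes "q \<in> vN_R" "finite P" "P \<subseteq> l2 \<times> l2" "\<epsilon> > 0"
  shows "\<exists>A c. finite A \<and> (\<forall>(f, h)\<in>P. cmod (l2_inner (q f) h - l2_inner (rho_comb A c f) h) < \<epsilon>)"
  using assms unfolding vN_R_def by blast

text \<open>Left and right translations commute exactly by associativity, and the identity survives
  weak limits.\<close>

lemma vN_R_lam_commute:
  assumes q: "q \<in> vN_R" and f: "f \<in> l2"
  shows "q (lam g f) = lam g (q f)"
proof (rule l2_eqI)
  fix h :: "'a \<Rightarrow> complex" assume h: "h \<in> l2"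
  define z where "z = l2_inner (q (lam g f)) h - l2_inner (lam g (q f)) h"
  have "cmod z < \<epsilon>" if "\<epsilon> > 0" for \<epsilon>
  proof -
    \<comment> \<open>One approximant must serve both matrix coefficients, so both pairs go into a
      single neighbourhood; the second pair has \<open>lam g\<close> moved onto
      \<open>h\<close>.\<close>
    have "\<exists>A c. finite A \<and> (\<forall>(f, h)\<in>{(lam g f, h), (f, lam (- g) h)}.
        cmod (l2_inner (q f) h - l2_inner (rho_comb A c f) h) < \<epsilon> / 2)"
      using q that f h by (intro vN_R_approx) (auto simp: lam_in_l2)
    then obtain A c where "cmod (l2_inner (q (lam g f)) h - l2_inner (rho_comb A c (lam g f)) h) < \<epsilon> / 2"
      "cmod (l2_inner (q f) (lam (- g) h) - l2_inner (rho_comb A c f) (lam (- g) h)) < \<epsilon> / 2"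
      by auto
    moreover have "z = (l2_inner (q (lam g f)) h - l2_inner (rho_comb A c (lam g f)) h)
        - (l2_inner (q f) (lam (- g) h) - l2_inner (rho_comb A c f) (lam (- g) h))"
      by (simp add: z_def l2_inner_lam rho_comb_lam)
    ultimately show ?thesis
      by (smt (verit) norm_triangle_ineq4 field_sum_of_halves)
  qed
  then have "z = 0" by (metis less_irrefl zero_less_norm_iff)
  then show "l2_inner (q (lam g f)) h = l2_inner (lam g (q f)) h" by (simp add: z_def)
qed

text \<open>The substitution \<open>y = x - g\<close> rewrites the convolution as a combination of
  left translates of \<open>f\<close>, finite because \<open>h\<close> has finite support.\<close>

lemma fourier_eq_sum_lam:
  assumes "fin_supp h"
  shows "fourier f h = (\<lambda>x. \<Sum>y | h y \<noteq> 0. h y * lam y f x)"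
proof
  fix x
  have "fourier f h x = (\<Sum>\<^sub>\<infinity>g. f g * h (x - g))"
    using assms by (simp add: fourier_def rho_adj_def rho_def)
  also have "\<dots> = (\<Sum>\<^sub>\<infinity>y. h y * f (- y + x))"
    by (rule infsum_reindex_bij_witness[of _ "\<lambda>y. - y + x" "\<lambda>g. x - g"])
       (simp_all add: minus_add add.assoc diff_conv_add_uminus mult.commute del: add_uminus_conv_diff)
  also have "\<dots> = (\<Sum>\<^sub>\<infinity>y\<in>{y. h y \<noteq> 0}. h y * f (- y + x))"
    by (rule infsum_cong_neutral) auto
  finally show "fourier f h x = (\<Sum>y | h y \<noteq> 0. h y * lam y f x)"
    using assms by (simp add: lam_def fin_supp_def)
qed

text \<open>The vector at the identity recovers the symbol of the operator; this is the source of
  injectivity.\<close>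

lemma fourier_delta_0: "fourier f (delta 0) = f"
proof -
  have s: "{y. delta 0 y \<noteq> 0} = {0 :: 'a}" by (auto simp: delta_def)
  have "fin_supp (delta (0 :: 'a))" by (simp add: fin_supp_def s)
  then show ?thesis by (simp add: fourier_eq_sum_lam s) (simp add: lam_def delta_def)
qed

lemma inj_fourier: "inj fourier"
  by (metis injI fourier_delta_0)

lemma op_series_eq_fourier: "op_series c = fourier (\<lambda>g. c (- g))"
proof -
  have "(\<Sum>\<^sub>\<infinity>g. c g * rho g h x) = (\<Sum>\<^sub>\<infinity>g. c (- g) * rho_adj g h x)" for h x
    by (rule infsum_reindex_bij_witness[of _ uminus uminus]) (simp_all add: rho_adj_def)
  then show ?thesis by (simp add: op_series_def fourier_def cong: if_cong)
qed

text \<open>Passing from \<open>rho\<close> to its adjoint reflects the coefficients through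
  inversion in the group, which preserves \<open>l2\<close>.\<close>

lemma L2R_eq_fourier_image: "L2R = fourier ` l2"
proof -
  have m: "(\<lambda>g. f (- g)) \<in> l2" if "f \<in> l2" for f :: "'a \<Rightarrow> complex"
    by (rule l2_reindex[OF _ that]) (rule involuntory_imp_bij, simp)
  show ?thesis
  proof (intro equalityI subsetI)
    fix F :: "('a \<Rightarrow> complex) \<Rightarrow> 'a \<Rightarrow> complex" assume "F \<in> fourier ` l2"
    then obtain f where f: "f \<in> l2" "F = fourier f" by blast
    then have "F = op_series (\<lambda>g. f (- g))" by (simp add: op_series_eq_fourier)
    with m[OF f(1)] show "F \<in> L2R" by (auto simp: L2R_def)
  qed (auto simp: L2R_def op_series_eq_fourier m)
qed

lemma bounded_op_l2_sum:
  assumes q: "bounded_op_l2 q" and "finite A" and f: "\<And>a. a \<in> A \<Longrightarrow> f a \<in> l2"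
  shows "q (\<lambda>x. \<Sum>a\<in>A. c a * f a x) = (\<lambda>x. \<Sum>a\<in>A. c a * q (f a) x)"
proof -
  have lin: "q (\<lambda>x. a * f x + b * g x) = (\<lambda>x. a * q f x + b * q g x)" if "f \<in> l2" "g \<in> l2" for f g a b
    using q that by (auto simp: bounded_op_l2_def)
  show ?thesis
    using assms(2) f
  proof (induction A rule: finite_induct)
    case empty
    show ?case using lin[OF l2_zero l2_zero, of 0 0] by simp
  next
    case (insert a A)
    have "(\<lambda>x. \<Sum>a\<in>A. c a * f a x) \<in> l2"
      using insert.prems by (intro l2_sum l2_scale) auto
    from lin[OF insert.prems[of a] this, of "c a" 1] insert show ?case by simp
  qed
qed

text \<open>On finitely supported \<open>h\<close>, linearity and commutation with
  \<open>lam\<close> carry \<open>q\<close> inside the sum of left translates; elsewhere both sides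
  are 0 by convention.\<close>

lemma qL2R_eq_fourier_image:
  assumes q: "q \<in> vN_R"
  shows "qL2R q = fourier ` q ` l2"
proof -
  have b: "bounded_op_l2 q" using q by (simp add: vN_R_def)
  have "(\<lambda>h. if fin_supp h then q (fourier f h) else (\<lambda>x. 0)) = fourier (q f)" if f: "f \<in> l2" for f
  proof
    fix h
    show "(if fin_supp h then q (fourier f h) else (\<lambda>x. 0)) = fourier (q f) h"
    proof (cases "fin_supp h")
      case True
      then have "q (fourier f h) = (\<lambda>x. \<Sum>y | h y \<noteq> 0. h y * q (lam y f) x)"
        unfolding fourier_eq_sum_lam[OF True]
        by (intro bounded_op_l2_sum b lam_in_l2 f) (simp add: fin_supp_def)
      with True show ?thesis by (simp add: fourier_eq_sum_lam vN_R_lam_commute[OF q f])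
    qed (simp add: fourier_def)
  qed
  then have eq: "(\<lambda>f h. if fin_supp h then q (fourier f h) else (\<lambda>x. 0)) ` l2 = (\<lambda>f. fourier (q f)) ` l2"
    by (rule image_cong[OF refl])
  have "qL2R q = (\<lambda>f h. if fin_supp h then q (fourier f h) else (\<lambda>x. 0)) ` l2"
    unfolding qL2R_def L2R_eq_fourier_image by blast
  then show ?thesis by (simp only: eq image_image)
qed

theorem theorem4p3:
  fixes V :: "('g::{group_add, countable} \<Rightarrow> complex) set"
  assumes "closed_subspace_l2 V"
  shows "(left_invariant V \<longleftrightarrow>
           (\<exists>q. q \<in> vN_R \<and> orth_proj_l2 q \<and> fourier ` V = qL2R q))
       \<and> (\<forall>q. q \<in> vN_R \<and> orth_proj_l2 q \<and> fourier ` V = qL2R q \<longrightarrow>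
              (\<forall>f\<in>l2. q f = proj_l2 V f))"
proof -
  note V = assms
  \<comment> \<open>Injectivity of \<open>fourier\<close> cancels it from the equality of
    images.\<close>
  have range: "q ` l2 = V" if "q \<in> vN_R" "fourier ` V = qL2R q" for q
    using that qL2R_eq_fourier_image[of q] by (simp add: inj_image_eq_iff[OF inj_fourier])
  have "\<exists>q. q \<in> vN_R \<and> orth_proj_l2 q \<and> fourier ` V = qL2R q" if "left_invariant V"
  proof (intro exI[of _ "proj_l2 V"] conjI)
    show q: "proj_l2 V \<in> vN_R" by (rule left_invariant_proj_in_vN_R[OF V that])
    show "orth_proj_l2 (proj_l2 V)" by (rule orth_proj_l2_proj_l2[OF V])
    have "proj_l2 V ` l2 = V"
      using proj_l2_in[OF V] proj_l2_fixes[OF V] closed_subspace_l2D(1)[OF V]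
      by (auto simp: image_iff) metis
    then show "fourier ` V = qL2R (proj_l2 V)" by (simp add: qL2R_eq_fourier_image[OF q])
  qed
  \<comment> \<open>The range of an operator commuting with left translations is stable under
    them.\<close>
  moreover have "left_invariant V" if q: "q \<in> vN_R" and "fourier ` V = qL2R q" for q
    unfolding left_invariant_def range[OF that, symmetric]
    by (auto simp: lam_in_l2 simp flip: vN_R_lam_commute[OF q])
  ultimately show ?thesis
    using orth_proj_l2_eq_proj_l2[OF _ V range] by blast
qed

end
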